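(* Let $k\ge2$ and let $a_1\ge a_2\ge\cdots\ge a_k$ be positive integers. Let \[G(x,y)=\sum_\lambda x^{\lambda_1+\lambda_3+\lambda_5+\cdots}y^{\lambda_2+\lambda_4+\cdots},\] the sum over all integer sequences $(\lambda_1,\ldots,\lambda_k)$ with $\lambda_1/a_1\ge\lambda_2/a_2\ge\cdots\ge\lambda_k/a_k\ge0$, and define $H(x,y)=(1-x)G(x,y)$. Then for all integers $l>0$ and $j\ge2-l$, $H(x^l,x^{j-1}y)$ equals $\sum_\lambda x^{\lambda_1+\lambda_3+\cdots}y^{\lambda_2+\lambda_4+\cdots}$ summed over the integer sequences $(\lambda_1,\ldots,\lambda_k)$ satisfying \[\lambda_1=l\left\lceil\frac{a_1\lambda_2}{a_2}\right\rceil+\sum_{i\ge1}\big((j-1)\lambda_{2i}+(l-1)\lambda_{2i+1}\big),\qquad \frac{\lambda_2}{a_2}\ge\frac{\lambda_3}{a_3}\ge\cdots\ge\frac{\lambda_k}{a_k}\ge0,\] where $\lambda_m=0$ for $m>k$. *)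

theory Defs
  imports "HOL-Analysis.Infinite_Sum" "HOL-Computational_Algebra.Formal_Laurent_Series"
begin

text \<open>
  Formal series in two variables are power series in \<open>y\<close> whose coefficients are Laurent series
  in \<open>x\<close>. This ring contains the power series in \<open>x\<close> and \<open>y\<close>, and the substitution
  \<open>x \<mapsto> x\<^sup>l\<close>, \<open>y \<mapsto> x\<^sup>d y\<close> makes sense in it for every \<open>l > 0\<close> and every integer \<open>d\<close>,
  including negative \<open>d\<close>.
\<close>

type_synonym bifps = "int fls fps"

abbreviation bicoeff :: "bifps \<Rightarrow> int \<Rightarrow> nat \<Rightarrow> int" where
  "bicoeff F p q \<equiv> fls_nth (fps_nth F q) p"

definition var_x :: bifps where
  "var_x = fps_const fls_X"

definition monom_xy :: "int \<Rightarrow> nat \<Rightarrow> bifps" where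
  "monom_xy p q = fps_const (fls_X_intpow p) * fps_X ^ q"

text \<open>The order matters: \<open>x\<close> is replaced in the coefficients first, since the \<open>x\<close> in \<open>x\<^sup>d y\<close>
  is the new variable.\<close>

definition subst_xy :: "nat \<Rightarrow> int \<Rightarrow> bifps \<Rightarrow> bifps" where
  "subst_xy l d F =
     fps_compose (Abs_fps (\<lambda>q. fls_compose_power (fps_nth F q) l))
                 (fps_const (fls_X_intpow d) * fps_X)"

text \<open>Convergence of a formal infinite sum is coefficientwise. As \<open>int\<close> is discrete,
  each coefficient receives only finitely many nonzero contributions.\<close>

definition formal_has_sum :: "('a \<Rightarrow> bifps) \<Rightarrow> 'a set \<Rightarrow> bifps \<Rightarrow> bool" where
  "formal_has_sum f S F \<longleftrightarrow>
     (\<forall>p q. ((\<lambda>s. bicoeff (f s) p q) has_sum bicoeff F p q) S)"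

definition formal_sum :: "('a \<Rightarrow> bifps) \<Rightarrow> 'a set \<Rightarrow> bifps" where
  "formal_sum f S = (THE F. formal_has_sum f S F)"

lemma formal_has_sum_unique:
  assumes "formal_has_sum f S F" "formal_has_sum f S F'"
  shows "F = F'"
  using assms unfolding formal_has_sum_def
  by (intro fps_ext fls_eqI) (blast intro: has_sum_unique)

lemma formal_sum_eqI: "formal_has_sum f S F \<Longrightarrow> formal_sum f S = F"
  unfolding formal_sum_def by (blast intro: formal_has_sum_unique)

lemma subst_xy_monom_xy:
  assumes "l > 0"
  shows "subst_xy l d (monom_xy p q) = monom_xy (int l * p + d * int q) q"
proof -
  have "Abs_fps (\<lambda>n. fls_compose_power (fps_nth (monom_xy p q) n) l) =
        fps_const (fls_X_intpow (int l * p)) * fps_X ^ q"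
    using assms by (auto intro!: fps_ext simp: monom_xy_def)
  then have "subst_xy l d (monom_xy p q) =
      fps_const (fls_X_intpow (int l * p)) * (fps_const (fls_X_intpow d) * fps_X) ^ q"
    unfolding subst_xy_def
    by (simp add: fps_compose_mult_distrib fps_X_power_compose)
  also have "\<dots> = fps_const (fls_X_intpow (int l * p) * fls_X_intpow d ^ q) * fps_X ^ q"
    by (simp add: power_mult_distrib fps_const_power flip: mult.assoc fps_const_mult)
  also have "\<dots> = monom_xy (int l * p + d * int q) q"
    by (simp only: fls_X_intpow_power fls_X_intpow_times_fls_X_intpow monom_xy_def ac_simps)
  finally show ?thesis .
qed

text \<open>A sequence \<open>(\<lambda>\<^sub>1, \<dots>, \<lambda>\<^sub>k)\<close> is a function on \<open>nat\<close> that vanishes outside \<open>{1..k}\<close>.\<close>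

definition seqs :: "nat \<Rightarrow> (nat \<Rightarrow> int) set" where
  "seqs k = {lam. \<forall>m. m \<notin> {1..k} \<longrightarrow> lam m = 0}"

text \<open>\<open>\<lambda>\<^sub>s / a\<^sub>s \<ge> \<dots> \<ge> \<lambda>\<^sub>k / a\<^sub>k \<ge> 0\<close>\<close>

definition ratio_chain :: "nat \<Rightarrow> nat \<Rightarrow> (nat \<Rightarrow> nat) \<Rightarrow> (nat \<Rightarrow> int) \<Rightarrow> bool" where
  "ratio_chain s k a lam \<longleftrightarrow>
     (\<forall>i\<in>{s..<k}. real_of_int (lam i) / real (a i) \<ge> real_of_int (lam (Suc i)) / real (a (Suc i)))
     \<and> real_of_int (lam k) / real (a k) \<ge> 0"

text \<open>\<open>x\<^bsup>\<lambda>\<^sub>1 + \<lambda>\<^sub>3 + \<dots>\<^esup> y\<^bsup>\<lambda>\<^sub>2 + \<lambda>\<^sub>4 + \<dots>\<^esup>\<close>; the truncation \<open>nat\<close> has no effect when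
  \<open>\<lambda>\<^sub>2, \<lambda>\<^sub>4, \<dots>\<close> are nonnegative, which holds in all sums below.\<close>

definition weight :: "nat \<Rightarrow> (nat \<Rightarrow> int) \<Rightarrow> bifps" where
  "weight k lam = monom_xy (\<Sum>i | i \<in> {1..k} \<and> odd i. lam i) (nat (\<Sum>i | i \<in> {1..k} \<and> even i. lam i))"

definition lecture_G :: "nat \<Rightarrow> (nat \<Rightarrow> nat) \<Rightarrow> bifps" where
  "lecture_G k a = formal_sum (weight k) {lam \<in> seqs k. ratio_chain 1 k a lam}"

definition lecture_H :: "nat \<Rightarrow> (nat \<Rightarrow> nat) \<Rightarrow> bifps" where
  "lecture_H k a = (1 - var_x) * lecture_G k a"

end

theory Submission
  imports Defs
begin

text \<open>
  Raising \<open>\<lambda>\<^sub>1\<close> by one preserves the chain condition and multiplies the weight by \<open>x\<close>, so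
  multiplying \<open>G\<close> by \<open>1 - x\<close> leaves exactly the sequences whose first entry is least possible,
  \<open>\<lambda>\<^sub>1 = \<lceil>a\<^sub>1 \<lambda>\<^sub>2 / a\<^sub>2\<rceil>\<close>. On these, the substitution \<open>x \<mapsto> x\<^sup>l\<close>, \<open>y \<mapsto> x\<^sup>j\<^sup>-\<^sup>1 y\<close> has
  the same effect on the weight as changing only \<open>\<lambda>\<^sub>1\<close>, to the value prescribed in the theorem.
\<close>

section \<open>Formal sums\<close>

lemma bicoeff_monom_xy:
  "bicoeff (monom_xy p q) p' q' = (if p' = p \<and> q' = q then 1 else 0)"
  by (auto simp: monom_xy_def)

lemma bicoeff_var_x_mult: "bicoeff (var_x * F) p q = bicoeff F (p - 1) q"
  by (simp add: var_x_def fls_X_times_conv_shift)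

lemma var_x_mult_monom_xy: "var_x * monom_xy p q = monom_xy (p + 1) q"
  by (intro fps_ext fls_eqI) (auto simp: bicoeff_var_x_mult bicoeff_monom_xy)

text \<open>Composing with \<open>x^d y\<close> multiplies the coefficient of \<open>y^q\<close> by
  \<open>x^(d q)\<close>, and replacing \<open>x\<close> by \<open>x^l\<close> leaves only exponents
  divisible by \<open>l\<close>; solving for the old exponent gives the quotient.\<close>

lemma bicoeff_subst_xy:
  assumes "l > 0"
  shows "bicoeff (subst_xy l d F) p q =
    (if int l dvd p - d * int q then bicoeff F ((p - d * int q) div int l) q else 0)"
proof -
  have "fps_nth (subst_xy l d F) q =
      fls_X_intpow d ^ q * fls_compose_power (fps_nth F q) l"
    by (simp add: subst_xy_def)
  also have "\<dots> = fls_X_intpow (int q * d) * fls_compose_power (fps_nth F q) l"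
    by (simp only: fls_X_intpow_power)
  also have "\<dots> = fls_shift (- (int q * d)) (fls_compose_power (fps_nth F q) l)"
    by (rule fls_X_intpow_times_conv_shift)
  finally show ?thesis
    using assms by (simp add: fls_nth_compose_power mult.commute)
qed

text \<open>For fixed \<open>q\<close> the limits must be the coefficients of a Laurent series in
  \<open>x\<close>, so their exponents need a lower bound. Finite fibers alone do not give one,
  hence \<open>N\<close>.\<close>

lemma formal_has_sum_exists:
  fixes N :: int
  assumes fin: "\<And>p q. finite {s \<in> S. bicoeff (f s) p q \<noteq> 0}"
    and low: "\<And>s p q. s \<in> S \<Longrightarrow> p < N \<Longrightarrow> bicoeff (f s) p q = 0"
  obtains F where "formal_has_sum f S F"
proof -
  define c where "c p q = (\<Sum>s | s \<in> S \<and> bicoeff (f s) p q \<noteq> 0. bicoeff (f s) p q)" for p q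
  have c: "((\<lambda>s. bicoeff (f s) p q) has_sum c p q) S" for p q
    by (rule has_sum_finite_neutralI[OF fin]) (auto simp: c_def)
  have "c p q = 0" if "p < N" for p q
    unfolding c_def using that low by (intro sum.neutral) auto
  then have "fls_nth (Abs_fls (\<lambda>p. c p q)) p = c p q" for p q
    by (intro nth_Abs_fls_lower_bound[of N]) auto
  then have "formal_has_sum f S (Abs_fps (\<lambda>q. Abs_fls (\<lambda>p. c p q)))"
    using c by (simp add: formal_has_sum_def)
  then show ?thesis
    by (rule that)
qed

lemma formal_has_sum_cong:
  "(\<And>s. s \<in> S \<Longrightarrow> f s = g s) \<Longrightarrow> formal_has_sum f S F \<longleftrightarrow> formal_has_sum g S F"
  by (simp add: formal_has_sum_def cong: has_sum_cong)

lemma formal_has_sum_Un_disjoint: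
  assumes "formal_has_sum f S F" "formal_has_sum f T F'" "S \<inter> T = {}"
  shows "formal_has_sum f (S \<union> T) (F + F')"
  using assms unfolding formal_has_sum_def by (auto intro: has_sum_Un_disjoint)

lemma formal_has_sum_reindex:
  assumes "inj_on h S"
  shows "formal_has_sum f (h ` S) F \<longleftrightarrow> formal_has_sum (\<lambda>s. f (h s)) S F"
  unfolding formal_has_sum_def by (simp add: has_sum_reindex[OF assms] o_def)

lemma formal_has_sum_var_x_mult:
  "formal_has_sum f S F \<Longrightarrow> formal_has_sum (\<lambda>s. var_x * f s) S (var_x * F)"
  by (simp add: formal_has_sum_def bicoeff_var_x_mult)

text \<open>The substitution never adds coefficients together: each new coefficient is zero or a
  single old one, so coefficientwise convergence carries over.\<close>

lemma formal_has_sum_subst_xy: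
  assumes "l > 0" "formal_has_sum f S F"
  shows "formal_has_sum (\<lambda>s. subst_xy l d (f s)) S (subst_xy l d F)"
  using assms by (simp add: formal_has_sum_def bicoeff_subst_xy)

section \<open>Chains of ratios\<close>

text \<open>Downward induction from \<open>k\<close>: nonnegativity of the last ratio passes up the
  chain, and the positive denominator transfers it to the entry.\<close>

lemma ratio_chain_nonneg:
  assumes "ratio_chain s k a lam" "\<forall>i\<in>{1..k}. a i > 0" "i \<in> {s..k}" "i \<ge> 1"
  shows "lam i \<ge> 0"
proof -
  have "i \<le> k" using assms(3) by simp
  then have "s \<le> i \<longrightarrow> real_of_int (lam i) / real (a i) \<ge> 0"
  proof (induction rule: inc_induct)
    case base
    then show ?case using assms(1) by (simp add: ratio_chain_def)
  next
    case (step n)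
    show ?case
    proof
      assume "s \<le> n"
      then have "real_of_int (lam (Suc n)) / real (a (Suc n)) \<le> real_of_int (lam n) / real (a n)"
        using assms(1) step.hyps by (simp add: ratio_chain_def)
      with step.IH \<open>s \<le> n\<close> show "0 \<le> real_of_int (lam n) / real (a n)"
        by linarith
    qed
  qed
  moreover have "a i > 0"
    using assms(2-4) by simp
  ultimately show ?thesis
    using assms(3) by (simp add: zero_le_divide_iff)
qed

lemma ratio_chain_2_update [simp]:
  "k \<ge> 2 \<Longrightarrow> ratio_chain 2 k a (lam(1 := v)) \<longleftrightarrow> ratio_chain 2 k a lam"
  by (auto simp: ratio_chain_def)

text \<open>Only the first inequality involves \<open>lam 1\<close>. Since \<open>lam 1\<close> is
  an integer, that inequality is a lower bound by a ceiling, and the ceiling depends on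
  \<open>lam 2\<close> alone.\<close>

lemma ratio_chain_1_iff:
  assumes "k \<ge> 2" "\<forall>i\<in>{1..k}. a i > 0"
  shows "ratio_chain 1 k a lam \<longleftrightarrow>
    \<lceil>real (a 1) * real_of_int (lam 2) / real (a 2)\<rceil> \<le> lam 1 \<and> ratio_chain 2 k a lam"
proof -
  have "{1..<k} = insert 1 {2..<k}"
    using assms(1) by auto
  moreover have "a 1 > 0" "a 2 > 0"
    using assms by auto
  then have "real_of_int (lam 2) / real (a 2) \<le> real_of_int (lam 1) / real (a 1) \<longleftrightarrow>
      real (a 1) * real_of_int (lam 2) / real (a 2) \<le> real_of_int (lam 1)"
    by (simp add: field_simps)
  ultimately show ?thesis
    by (simp add: ratio_chain_def ceiling_le_iff numeral_2_eq_2)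
qed

lemma seqs_update [simp]: "k \<ge> 2 \<Longrightarrow> lam(1 := v) \<in> seqs k \<longleftrightarrow> lam \<in> seqs k"
  by (auto simp: seqs_def)

section \<open>Odd and even parts of the weight\<close>

definition odd_tail :: "nat \<Rightarrow> (nat \<Rightarrow> int) \<Rightarrow> int" where
  "odd_tail k lam = (\<Sum>i | i \<in> {2..k} \<and> odd i. lam i)"

definition even_sum :: "nat \<Rightarrow> (nat \<Rightarrow> int) \<Rightarrow> int" where
  "even_sum k lam = (\<Sum>i | i \<in> {1..k} \<and> even i. lam i)"

text \<open>Isolates the first entry: \<open>odd_tail\<close> and \<open>even_sum\<close> do not
  change when \<open>lam 1\<close> is altered.\<close>

lemma weight_eq:
  assumes "k \<ge> 2"
  shows "weight k lam = monom_xy (lam 1 + odd_tail k lam) (nat (even_sum k lam))"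
proof -
  have "{i. i \<in> {1..k} \<and> odd i} = insert 1 {i. i \<in> {2..k} \<and> odd i}"
    using assms by (auto simp: not_less_eq_eq numeral_2_eq_2 le_Suc_eq)
  then show ?thesis
    by (simp add: weight_def odd_tail_def even_sum_def)
qed

lemma odd_tail_update [simp]: "odd_tail k (lam(1 := v)) = odd_tail k lam"
  unfolding odd_tail_def by (intro sum.cong) auto

lemma even_sum_update [simp]: "even_sum k (lam(1 := v)) = even_sum k lam"
  unfolding even_sum_def by (intro sum.cong) auto

text \<open>The indices \<open>2 * i\<close> run past \<open>k\<close>, but entries there are
  zero.\<close>

lemma even_sum_reindex:
  assumes "lam \<in> seqs k"
  shows "(\<Sum>i = 1..k. lam (2 * i)) = even_sum k lam"
proof -
  have "(\<Sum>i = 1..k. lam (2 * i)) = sum lam ((*) 2 ` {1..k})"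
    by (subst sum.reindex) (auto simp: inj_on_def)
  also have "\<dots> = even_sum k lam"
    unfolding even_sum_def using assms
    by (intro sum.mono_neutral_right) (auto simp: seqs_def elim!: evenE)
  finally show ?thesis .
qed

text \<open>Starting at \<open>i = 1\<close> gives the indices 3, 5, and so on, which leaves out
  \<open>lam 1\<close> just as \<open>odd_tail\<close> does.\<close>

lemma odd_tail_reindex:
  assumes "lam \<in> seqs k"
  shows "(\<Sum>i = 1..k. lam (2 * i + 1)) = odd_tail k lam"
proof -
  have "(\<Sum>i = 1..k. lam (2 * i + 1)) = sum lam ((\<lambda>i. 2 * i + 1) ` {1..k})"
    by (subst sum.reindex) (auto simp: inj_on_def)
  also have "\<dots> = odd_tail k lam"
    unfolding odd_tail_def using assms
    by (intro sum.mono_neutral_right) (auto simp: seqs_def image_iff elim!: oddE)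
  finally show ?thesis .
qed

text \<open>Even indices start at 2, so the chain from 2 suffices. This makes the truncation
  \<open>nat\<close> in the weight harmless without any condition on \<open>lam 1\<close>.\<close>

lemma even_sum_nonneg:
  assumes "ratio_chain 2 k a lam" "\<forall>i\<in>{1..k}. a i > 0"
  shows "even_sum k lam \<ge> 0"
  unfolding even_sum_def
proof (rule sum_nonneg)
  fix i assume "i \<in> {i. i \<in> {1..k} \<and> even i}"
  then have "i \<in> {2..k}" "i \<ge> 1"
    by (auto elim!: evenE)
  then show "lam i \<ge> 0"
    using ratio_chain_nonneg[OF assms] by blast
qed

section \<open>Summability of the weights\<close>

lemma weight_low:
  assumes "\<forall>i\<in>{1..k}. a i > 0" "ratio_chain 1 k a lam" "p < 0"
  shows "bicoeff (weight k lam) p q = 0"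
proof -
  have "(\<Sum>i | i \<in> {1..k} \<and> odd i. lam i) \<ge> 0"
    using ratio_chain_nonneg[OF assms(2,1)] by (intro sum_nonneg) auto
  then show ?thesis
    using assms(3) by (simp add: weight_def bicoeff_monom_xy)
qed

text \<open>The entries are nonnegative with total \<open>p + int q\<close>, so each of them is at
  most \<open>p + int q\<close>.\<close>

lemma finite_weight_fiber:
  assumes a: "\<forall>i\<in>{1..k}. a i > 0"
  shows "finite {lam \<in> seqs k. ratio_chain 1 k a lam \<and> bicoeff (weight k lam) p q \<noteq> 0}"
proof (rule finite_subset)
  show "finite {lam. \<forall>i. (i \<in> {1..k} \<longrightarrow> lam i \<in> {0..p + int q}) \<and> (i \<notin> {1..k} \<longrightarrow> lam i = (0::int))}"
    by (intro finite_set_of_finite_funs) auto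
  have "lam i \<in> {0..p + int q}"
    if lam: "ratio_chain 1 k a lam" "bicoeff (weight k lam) p q \<noteq> 0" and i: "i \<in> {1..k}" for lam i
  proof -
    have nonneg: "lam n \<ge> 0" if "n \<in> {1..k}" for n
      using ratio_chain_nonneg[OF lam(1) a] that by auto
    let ?o = "\<Sum>i | i \<in> {1..k} \<and> odd i. lam i" and ?e = "\<Sum>i | i \<in> {1..k} \<and> even i. lam i"
    have "?o \<ge> 0" "?e \<ge> 0"
      using nonneg by (auto intro: sum_nonneg)
    moreover have "p = ?o" "q = nat ?e"
      using lam(2) by (simp_all add: weight_def bicoeff_monom_xy split: if_splits)
    moreover have "lam i \<le> ?e" if "even i"
      using i that nonneg by (intro member_le_sum) auto
    moreover have "lam i \<le> ?o" if "odd i"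
      using i that nonneg by (intro member_le_sum) auto
    ultimately show ?thesis
      using nonneg[OF i] by (cases "even i") auto
  qed
  then show "{lam \<in> seqs k. ratio_chain 1 k a lam \<and> bicoeff (weight k lam) p q \<noteq> 0} \<subseteq>
      {lam. \<forall>i. (i \<in> {1..k} \<longrightarrow> lam i \<in> {0..p + int q}) \<and> (i \<notin> {1..k} \<longrightarrow> lam i = 0)}"
    by (auto simp: seqs_def)
qed

text \<open>Stated for a subset \<open>S\<close> because it serves both the full index set of
  \<open>G\<close> and its part with least first entry.\<close>

lemma formal_has_sum_weight_exists:
  assumes "\<forall>i\<in>{1..k}. a i > 0" "S \<subseteq> {lam \<in> seqs k. ratio_chain 1 k a lam}"
  obtains F where "formal_has_sum (weight k) S F"
proof (rule formal_has_sum_exists)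
  show "finite {lam \<in> S. bicoeff (weight k lam) p q \<noteq> 0}" for p q
    by (rule finite_subset[OF _ finite_weight_fiber[OF assms(1), of q p]]) (use assms(2) in auto)
  show "bicoeff (weight k lam) p q = 0" if "lam \<in> S" "p < 0" for lam p q
    using that weight_low[OF assms(1)] assms(2) by blast
qed

section \<open>The series H\<close>

declare One_nat_def [simp del]

lemma formal_has_sum_lecture_H:
  assumes k: "k \<ge> 2" and a: "\<forall>i\<in>{1..k}. a i > 0"
  shows "formal_has_sum (weight k)
    {lam \<in> seqs k. lam 1 = \<lceil>real (a 1) * real_of_int (lam 2) / real (a 2)\<rceil> \<and> ratio_chain 2 k a lam}
    (lecture_H k a)"
    (is "formal_has_sum _ ?M _")
proof -
  let ?L = "{lam \<in> seqs k. ratio_chain 1 k a lam}"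
  let ?shift = "\<lambda>lam :: nat \<Rightarrow> int. lam(1 := lam 1 + 1)"
  have unshift: "?shift (lam(1 := lam 1 - 1)) = lam" for lam
    by (simp add: fun_eq_iff)
  obtain G where G: "formal_has_sum (weight k) ?L G"
    using formal_has_sum_weight_exists[OF a subset_refl] by blast
  have "?M \<subseteq> ?L"
    by (auto simp: ratio_chain_1_iff[OF k a])
  then obtain H where H: "formal_has_sum (weight k) ?M H"
    using formal_has_sum_weight_exists[OF a] by blast
  have inj: "inj_on ?shift ?L"
    by (rule inj_on_inverseI[of _ "\<lambda>lam. lam(1 := lam 1 - 1)"]) simp
  have "weight k (?shift lam) = var_x * weight k lam" for lam
    unfolding weight_eq[OF k] var_x_mult_monom_xy by (simp add: algebra_simps)
  then have xG: "formal_has_sum (weight k) (?shift ` ?L) (var_x * G)"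
    using formal_has_sum_var_x_mult[OF G] by (simp add: formal_has_sum_reindex[OF inj])
  \<comment> \<open>Raising the first entry makes the ceiling bound strict, so the image is the
    complement of \<open>?M\<close> in \<open>?L\<close>.\<close>
  have shift: "?shift ` ?L = {lam \<in> seqs k.
      \<lceil>real (a 1) * real_of_int (lam 2) / real (a 2)\<rceil> < lam 1 \<and> ratio_chain 2 k a lam}"
    (is "_ = ?R")
  proof
    show "?shift ` ?L \<subseteq> ?R"
      using k by (auto simp: ratio_chain_1_iff[OF k a])
    show "?R \<subseteq> ?shift ` ?L"
    proof
      fix lam assume "lam \<in> ?R"
      then have "lam(1 := lam 1 - 1) \<in> ?L"
        using k by (auto simp: ratio_chain_1_iff[OF k a])
      then have "?shift (lam(1 := lam 1 - 1)) \<in> ?shift ` ?L"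
        by (rule imageI)
      then show "lam \<in> ?shift ` ?L"
        by (simp only: unshift)
    qed
  qed
  have "?M \<inter> ?shift ` ?L = {}"
    unfolding shift by auto
  then have "formal_has_sum (weight k) (?M \<union> ?shift ` ?L) (H + var_x * G)"
    by (rule formal_has_sum_Un_disjoint[OF H xG])
  moreover have "?M \<union> ?shift ` ?L = ?L"
    unfolding shift by (auto simp: ratio_chain_1_iff[OF k a])
  ultimately have "formal_has_sum (weight k) ?L (H + var_x * G)"
    by (simp only:)
  \<comment> \<open>Uniqueness of formal sums turns the splitting of \<open>?L\<close> into this
    equation, which rearranges to \<open>H = (1 - x) G\<close>.\<close>
  then have "G = H + var_x * G"
    by (rule formal_has_sum_unique[OF G])
  moreover have "lecture_G k a = G"
    unfolding lecture_G_def using G by (rule formal_sum_eqI)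
  ultimately have "lecture_H k a = H"
    by (simp add: lecture_H_def algebra_simps)
  with H show ?thesis
    by simp
qed

theorem theorem5:
  fixes k l :: nat and a :: "nat \<Rightarrow> nat" and j :: int
  assumes "k \<ge> 2"
    and "\<forall>i\<in>{1..k}. a i > 0"
    and "\<forall>i\<in>{1..<k}. a i \<ge> a (Suc i)"
    and "l > 0"
    and "j \<ge> 2 - int l"
  shows "formal_has_sum (weight k)
           {lam \<in> seqs k.
              lam 1 = int l * \<lceil>real (a 1) * real_of_int (lam 2) / real (a 2)\<rceil>
                + (\<Sum>i = 1..k. (j - 1) * lam (2 * i) + (int l - 1) * lam (2 * i + 1))
              \<and> ratio_chain 2 k a lam}
           (subst_xy l (j - 1) (lecture_H k a))"
proof -
  note k = assms(1) and a = assms(2)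
  define c where "c lam = \<lceil>real (a 1) * real_of_int (lam 2) / real (a 2)\<rceil>" for lam :: "nat \<Rightarrow> int"
  \<comment> \<open>On \<open>M\<close> the substitution gives \<open>x\<close> the exponent
    \<open>l (c + odd_tail) + (j - 1) even_sum\<close>. One copy of \<open>odd_tail\<close> is still
    contributed by the unchanged later entries; the rest is \<open>t\<close>.\<close>
  define t where "t lam = int l * c lam + (j - 1) * even_sum k lam + (int l - 1) * odd_tail k lam" for lam
  define M where "M = {lam \<in> seqs k. lam 1 = c lam \<and> ratio_chain 2 k a lam}"
  define T where "T = {lam \<in> seqs k. lam 1 = t lam \<and> ratio_chain 2 k a lam}"
  let ?h = "\<lambda>lam. lam(1 := t lam)"
  have c_update [simp]: "c (lam(1 := v)) = c lam" for lam v
    by (simp add: c_def)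
  have t_update [simp]: "t (lam(1 := v)) = t lam" for lam v
    by (simp add: t_def)
  have inj: "inj_on ?h M"
  proof (rule inj_on_inverseI)
    \<comment> \<open>Resetting the first entry to \<open>c\<close> undoes \<open>?h\<close> on
      \<open>M\<close>, as \<open>c\<close> does not depend on that entry.\<close>
    show "(?h lam)(1 := c (?h lam)) = lam" if "lam \<in> M" for lam
      using that by (auto simp: M_def fun_eq_iff)
  qed
  have image: "?h ` M = T"
  proof
    show "?h ` M \<subseteq> T"
      using k by (auto simp: M_def T_def)
    show "T \<subseteq> ?h ` M"
    proof
      fix lam assume "lam \<in> T"
      then have "lam(1 := c lam) \<in> M" "?h (lam(1 := c lam)) = lam"
        using k by (auto simp: M_def T_def fun_eq_iff)
      then show "lam \<in> ?h ` M"
        by (intro image_eqI[OF sym])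
    qed
  qed
  have subst_weight: "subst_xy l (j - 1) (weight k lam) = weight k (?h lam)" if "lam \<in> M" for lam
  proof -
    \<comment> \<open>Nonnegativity removes \<open>nat\<close>, so the exponent of \<open>x\<close>
      gains exactly \<open>(j - 1) * even_sum k lam\<close>.\<close>
    have "even_sum k lam \<ge> 0" and "lam 1 = c lam"
      using that even_sum_nonneg a by (auto simp: M_def)
    then show ?thesis
      unfolding weight_eq[OF k] subst_xy_monom_xy[OF \<open>l > 0\<close>]
      by (simp add: t_def algebra_simps)
  qed
  have "formal_has_sum (\<lambda>lam. subst_xy l (j - 1) (weight k lam)) M
      (subst_xy l (j - 1) (lecture_H k a))"
    unfolding M_def c_def
    by (rule formal_has_sum_subst_xy[OF \<open>l > 0\<close> formal_has_sum_lecture_H[OF k a]])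
  then have "formal_has_sum (\<lambda>lam. weight k (?h lam)) M (subst_xy l (j - 1) (lecture_H k a))"
    by (simp only: formal_has_sum_cong[OF subst_weight])
  then have "formal_has_sum (weight k) T (subst_xy l (j - 1) (lecture_H k a))"
    by (simp add: formal_has_sum_reindex[OF inj] flip: image)
  \<comment> \<open>Restores the form of the prescribed first entry; \<open>lam \<in> seqs k\<close>
    disposes of the indices above \<open>k\<close>.\<close>
  moreover have "(\<Sum>i = 1..k. (j - 1) * lam (2 * i) + (int l - 1) * lam (2 * i + 1)) =
      (j - 1) * even_sum k lam + (int l - 1) * odd_tail k lam" if "lam \<in> seqs k" for lam
    unfolding sum.distrib sum_distrib_left[symmetric]
      even_sum_reindex[OF that] odd_tail_reindex[OF that] ..
  then have "T = {lam \<in> seqs k. lam 1 = int l * c lam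
      + (\<Sum>i = 1..k. (j - 1) * lam (2 * i) + (int l - 1) * lam (2 * i + 1))
      \<and> ratio_chain 2 k a lam}"
    by (auto simp: T_def t_def add.assoc)
  ultimately show ?thesis
    by (simp only: c_def)
qed

end
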